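(* Up to relabeling the digits there are exactly $12$ complete $4$ by $4$ Sudokus. To each associate the multiset of the types (A, B, C, D) of the four preference profiles given by its four digits. Then among these $12$ Sudokus there are exactly: one with types AAAA, four with types AABB, two with types BBBB, four with types BBCD, and one with types CCDD (and no other multisets of types occur). The Sudokus with types AAAA, AABB and BBBB are disjoint-groups Sudokus, the Sudoku with types CCDD is a joint-groups Sudoku, and those with types BBCD are neither.
   Context: A complete $4$ by $4$ Sudoku (the case $n=2$) is a $4$ by $4$ grid divided into four $2$ by $2$ boxes, filled with the digits $1,2,3,4$ so that every row, column and box contains each digit exactly once. Bands are the two horizontal strips of boxes and stacks are the two vertical strips of boxes. Positions inside a box are given by coordinates (row from the top, column from the left). Each digit determines a preference profile of $2$ men (stacks) and $2$ women (bands): if the digit is at position $(i,j)$ within the box at the intersection of band $w$ and stack $m$, then woman $w$ ranks man $m$ as $i$ and man $m$ ranks woman $w$ as $j$ (rank $1$ is the most preferred). Types of profiles for $n=2$ (each up to relabeling the men, relabeling the women, and interchanging the roles of men and women): Type A: both men prefer the first woman, and both women prefer the first man. Type B: both men prefer the first woman; the first woman prefers the first man, and the second woman prefers the second man. Type C: the first man prefers the first woman, the second man prefers the second woman, the first woman prefers the first man, and the second woman prefers the second man. Type D: the first man prefers the first woman, the second man prefers the second woman, the first woman prefers the second man, and the second woman prefers the first man. A disjoint-groups Sudoku is a complete Sudoku in which, for each fixed position within a box, the digits in that position are distinct across all boxes. A joint-groups Sudoku is a complete Sudoku in which for each digit there is a function $f$ (depending on the digit) such that in every box the digit occupies a position of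 the form $(i,f(i))$. *)

theory Defs
  imports "HOL-Library.FuncSet" "HOL-Library.Multiset" "HOL-Combinatorics.Permutations"
begin

section \<open>Complete 4 by 4 Sudokus\<close>

text \<open>A grid maps (row from the top, column from the left) to a digit. All indices (rows, columns,
  bands, stacks, positions inside a box) start at 1.\<close>

type_synonym grid = "nat \<times> nat \<Rightarrow> nat"

definition digits :: "nat set" where "digits = {1..4}"

definition cells :: "(nat \<times> nat) set" where "cells = {1..4} \<times> {1..4}"

definition cell :: "nat \<Rightarrow> nat \<Rightarrow> nat \<times> nat \<Rightarrow> nat \<times> nat" where
  "cell w m p = (2 * (w - 1) + fst p, 2 * (m - 1) + snd p)"
  \<comment> \<open>position \<open>p\<close> of the box at the intersection of band \<open>w\<close> and stack \<open>m\<close>\<close>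

text \<open>Grids are extensional, i.e. \<open>undefined\<close> outside the 16 cells, so that they can be counted.\<close>

definition sudokus :: "grid set" where
  "sudokus = {S \<in> cells \<rightarrow>\<^sub>E digits.
     (\<forall>r\<in>{1..4}. \<forall>d\<in>digits. \<exists>!c. c \<in> {1..4} \<and> S (r, c) = d) \<and>
     (\<forall>c\<in>{1..4}. \<forall>d\<in>digits. \<exists>!r. r \<in> {1..4} \<and> S (r, c) = d) \<and>
     (\<forall>w\<in>{1,2}. \<forall>m\<in>{1,2}. \<forall>d\<in>digits. \<exists>!p. p \<in> {1,2} \<times> {1,2} \<and> S (cell w m p) = d)}"

definition relabeling :: "(grid \<times> grid) set" where
  "relabeling = {(S, T). S \<in> sudokus \<and> T \<in> sudokus \<and>
     (\<exists>\<pi>. \<pi> permutes digits \<and> (\<forall>x\<in>cells. T x = \<pi> (S x)))}"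

definition disjoint_groups :: "grid \<Rightarrow> bool" where
  "disjoint_groups S \<longleftrightarrow> S \<in> sudokus \<and>
     (\<forall>p\<in>{1,2} \<times> {1,2}. inj_on (\<lambda>(w, m). S (cell w m p)) ({1,2} \<times> {1,2}))"

definition digit_pos :: "grid \<Rightarrow> nat \<Rightarrow> nat \<Rightarrow> nat \<Rightarrow> nat \<times> nat" where
  "digit_pos S d w m = (THE p. p \<in> {1,2} \<times> {1,2} \<and> S (cell w m p) = d)"

definition joint_groups :: "grid \<Rightarrow> bool" where
  "joint_groups S \<longleftrightarrow> S \<in> sudokus \<and>
     (\<forall>d\<in>digits. \<exists>f :: nat \<Rightarrow> nat. \<forall>w\<in>{1,2}. \<forall>m\<in>{1,2}. \<exists>i. digit_pos S d w m = (i, f i))"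


section \<open>Preference profiles of two men and two women\<close>

text \<open>In a profile \<open>(\<mu>, \<omega>)\<close>, man \<open>m\<close> ranks woman \<open>w\<close> as \<open>\<mu> m w\<close> and woman \<open>w\<close> ranks man \<open>m\<close>
  as \<open>\<omega> w m\<close>. Only arguments in \<open>{1,2}\<close> matter.\<close>

type_synonym ranking = "nat \<Rightarrow> nat \<Rightarrow> nat"
type_synonym profile = "ranking \<times> ranking"

definition is_profile :: "profile \<Rightarrow> bool" where
  "is_profile P \<longleftrightarrow> (\<forall>k\<in>{1,2}. bij_betw (fst P k) {1,2} {1,2} \<and> bij_betw (snd P k) {1,2} {1,2})"

definition digit_profile :: "grid \<Rightarrow> nat \<Rightarrow> profile" where
  "digit_profile S d = (\<lambda>m w. snd (digit_pos S d w m), \<lambda>w m. fst (digit_pos S d w m))"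

definition relabel_profile :: "(nat \<Rightarrow> nat) \<Rightarrow> (nat \<Rightarrow> nat) \<Rightarrow> profile \<Rightarrow> profile" where
  "relabel_profile \<sigma> \<tau> = (\<lambda>(\<mu>, \<omega>). (\<lambda>m w. \<mu> (\<sigma> m) (\<tau> w), \<lambda>w m. \<omega> (\<tau> w) (\<sigma> m)))"

definition interchange :: "profile \<Rightarrow> profile" where
  "interchange = (\<lambda>(\<mu>, \<omega>). (\<omega>, \<mu>))"

definition man_prefers :: "profile \<Rightarrow> nat \<Rightarrow> nat \<Rightarrow> bool" where
  "man_prefers P m w \<longleftrightarrow> fst P m w = 1"

definition woman_prefers :: "profile \<Rightarrow> nat \<Rightarrow> nat \<Rightarrow> bool" where
  "woman_prefers P w m \<longleftrightarrow> snd P w m = 1"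

datatype ptype = TypeA | TypeB | TypeC | TypeD

fun standard_form :: "ptype \<Rightarrow> profile \<Rightarrow> bool" where
  "standard_form TypeA P \<longleftrightarrow> man_prefers P 1 1 \<and> man_prefers P 2 1 \<and>
                         woman_prefers P 1 1 \<and> woman_prefers P 2 1"
| "standard_form TypeB P \<longleftrightarrow> man_prefers P 1 1 \<and> man_prefers P 2 1 \<and>
                         woman_prefers P 1 1 \<and> woman_prefers P 2 2"
| "standard_form TypeC P \<longleftrightarrow> man_prefers P 1 1 \<and> man_prefers P 2 2 \<and>
                         woman_prefers P 1 1 \<and> woman_prefers P 2 2"
| "standard_form TypeD P \<longleftrightarrow> man_prefers P 1 1 \<and> man_prefers P 2 2 \<and>
                         woman_prefers P 1 2 \<and> woman_prefers P 2 1"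

definition has_type :: "profile \<Rightarrow> ptype \<Rightarrow> bool" where
  "has_type P t \<longleftrightarrow> (\<exists>\<sigma> \<tau>. \<sigma> permutes {1,2} \<and> \<tau> permutes {1,2} \<and>
     (standard_form t (relabel_profile \<sigma> \<tau> P) \<or>
      standard_form t (relabel_profile \<sigma> \<tau> (interchange P))))"

definition type_of :: "profile \<Rightarrow> ptype" where
  "type_of P = (THE t. has_type P t)"

definition types :: "grid \<Rightarrow> ptype multiset" where
  "types S = image_mset (\<lambda>d. type_of (digit_profile S d)) (mset_set digits)"


section \<open>The definite descriptions are justified\<close>

lemma sudokus_ex1:
  assumes "S \<in> sudokus" "d \<in> digits"
  shows "r \<in> {1..4} \<Longrightarrow> \<exists>!c. c \<in> {1..4} \<and> S (r, c) = d"
    and "c \<in> {1..4} \<Longrightarrow> \<exists>!r. r \<in> {1..4} \<and> S (r, c) = d"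
    and "w \<in> {1,2} \<Longrightarrow> m \<in> {1,2} \<Longrightarrow> \<exists>!p. p \<in> {1,2} \<times> {1,2} \<and> S (cell w m p) = d"
proof -
  note D = assms(1)[unfolded sudokus_def mem_Collect_eq, THEN conjunct2]
  note * = D[THEN conjunct1] D[THEN conjunct2, THEN conjunct1] D[THEN conjunct2, THEN conjunct2]
  show "r \<in> {1..4} \<Longrightarrow> \<exists>!c. c \<in> {1..4} \<and> S (r, c) = d"
    by (rule bspec[OF bspec[OF *(1)] assms(2)])
  show "c \<in> {1..4} \<Longrightarrow> \<exists>!r. r \<in> {1..4} \<and> S (r, c) = d"
    by (rule bspec[OF bspec[OF *(2)] assms(2)])
  show "w \<in> {1,2} \<Longrightarrow> m \<in> {1,2} \<Longrightarrow> \<exists>!p. p \<in> {1,2} \<times> {1,2} \<and> S (cell w m p) = d"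
    by (rule bspec[OF bspec[OF bspec[OF *(3)]] assms(2)])
qed

lemma digit_pos:
  assumes "S \<in> sudokus" "d \<in> digits" "w \<in> {1,2}" "m \<in> {1,2}"
  shows "digit_pos S d w m \<in> {1,2} \<times> {1,2}" "S (cell w m (digit_pos S d w m)) = d"
proof -
  have *: "digit_pos S d w m \<in> {1,2} \<times> {1,2} \<and> S (cell w m (digit_pos S d w m)) = d"
    unfolding digit_pos_def by (rule theI'[OF sudokus_ex1(3)[OF assms]])
  show "digit_pos S d w m \<in> {1,2} \<times> {1,2}" using * by (rule conjunct1)
  show "S (cell w m (digit_pos S d w m)) = d" using * by (rule conjunct2)
qed

lemma bij_betw_12_iff:
  "bij_betw f {1, 2::nat} {1, 2::nat} \<longleftrightarrow> f 1 = 1 \<and> f 2 = 2 \<or> f 1 = 2 \<and> f 2 = 1"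
proof -
  have "inj_on f {1, 2} \<longleftrightarrow> f 1 \<noteq> f 2" by (simp add: inj_on_insert)
  moreover have "f ` {1, 2} = {1, 2} \<longleftrightarrow> f 1 = 1 \<and> f 2 = 2 \<or> f 1 = 2 \<and> f 2 = 1"
    by (simp only: image_insert image_empty doubleton_eq_iff)
  moreover have "(1::nat) \<noteq> 2" by simp
  ultimately show ?thesis unfolding bij_betw_def by metis
qed

lemma is_profile_digit_profile:
  assumes S: "S \<in> sudokus" and d: "d \<in> digits"
  shows "is_profile (digit_profile S d)"
proof -
  have row: "c = c'" if "r \<in> {1..4}" "c \<in> {1..4}" "c' \<in> {1..4}" "S (r, c) = d" "S (r, c') = d"
    for r c c'
    using ex1E[OF sudokus_ex1(1)[OF S d that(1)]] that by metis
  have col: "r = r'" if "c \<in> {1..4}" "r \<in> {1..4}" "r' \<in> {1..4}" "S (r, c) = d" "S (r', c) = d"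
    for r r' c
    using ex1E[OF sudokus_ex1(2)[OF S d that(1)]] that by metis
  have rng: "fst (digit_pos S d w m) \<in> {1,2}" "snd (digit_pos S d w m) \<in> {1,2}"
    if "w \<in> {1,2}" "m \<in> {1,2}" for w m
    using digit_pos(1)[OF S d that] by (simp_all only: mem_Times_iff)
  have women: "fst (digit_pos S d w 1) \<noteq> fst (digit_pos S d w 2)" if w: "w \<in> {1,2}" for w
  proof
    obtain i j i' j' where p: "digit_pos S d w 1 = (i, j)" "digit_pos S d w 2 = (i', j')"
      by (metis surj_pair)
    have ij: "i \<in> {1,2}" "j \<in> {1,2}" "i' \<in> {1,2}" "j' \<in> {1,2}"
      using rng[OF w, of 1] rng[OF w, of 2] unfolding p by simp_all
    have S1: "S (2 * (w - 1) + i, j) = d" "S (2 * (w - 1) + i', 2 + j') = d"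
      using digit_pos(2)[OF S d w, of 1] digit_pos(2)[OF S d w, of 2] unfolding p
      by (simp_all add: cell_def)
    assume "fst (digit_pos S d w 1) = fst (digit_pos S d w 2)"
    then have "i' = i" unfolding p by simp
    with row[OF _ _ _ S1(1), of "2 + j'"] S1(2) have "j = 2 + j'" using ij w by fastforce
    then show False using ij by auto
  qed
  have men: "snd (digit_pos S d 1 m) \<noteq> snd (digit_pos S d 2 m)" if m: "m \<in> {1,2}" for m
  proof
    obtain i j i' j' where p: "digit_pos S d 1 m = (i, j)" "digit_pos S d 2 m = (i', j')"
      by (metis surj_pair)
    have ij: "i \<in> {1,2}" "j \<in> {1,2}" "i' \<in> {1,2}" "j' \<in> {1,2}"
      using rng[OF _ m, of 1] rng[OF _ m, of 2] unfolding p by simp_all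
    have S1: "S (i, 2 * (m - 1) + j) = d" "S (2 + i', 2 * (m - 1) + j') = d"
      using digit_pos(2)[OF S d _ m, of 1] digit_pos(2)[OF S d _ m, of 2] unfolding p
      by (simp_all add: cell_def)
    assume "snd (digit_pos S d 1 m) = snd (digit_pos S d 2 m)"
    then have "j' = j" unfolding p by simp
    with col[OF _ _ _ S1(1), of "2 + i'"] S1(2) have "i = 2 + i'" using ij m by fastforce
    then show False using ij by auto
  qed
  show ?thesis
    unfolding is_profile_def bij_betw_12_iff digit_profile_def fst_conv snd_conv
  proof (intro ballI conjI)
    fix k :: nat assume k: "k \<in> {1,2}"
    show "snd (digit_pos S d 1 k) = 1 \<and> snd (digit_pos S d 2 k) = 2 \<or>
        snd (digit_pos S d 1 k) = 2 \<and> snd (digit_pos S d 2 k) = 1"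
      using men[OF k] rng[OF _ k, of 1] rng[OF _ k, of 2] by auto
    show "fst (digit_pos S d k 1) = 1 \<and> fst (digit_pos S d k 2) = 2 \<or>
        fst (digit_pos S d k 1) = 2 \<and> fst (digit_pos S d k 2) = 1"
      using women[OF k] rng[OF k, of 1] rng[OF k, of 2] by auto
  qed
qed

lemma permutes_12_iff:
  "\<sigma> permutes {1, 2::nat} \<longleftrightarrow> \<sigma> = id \<or> \<sigma> = Transposition.transpose 1 2"
proof
  assume p: "\<sigma> permutes {1, 2}"
  have out: "\<sigma> x = x" if "x \<noteq> 1" "x \<noteq> 2" for x
    using permutes_not_in[OF p] that by simp
  have "\<sigma> 1 = 1 \<and> \<sigma> 2 = 2 \<or> \<sigma> 1 = 2 \<and> \<sigma> 2 = 1"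
    using permutes_imp_bij[OF p] by (simp only: bij_betw_12_iff)
  then show "\<sigma> = id \<or> \<sigma> = Transposition.transpose 1 2"
  proof
    assume "\<sigma> 1 = 1 \<and> \<sigma> 2 = 2"
    then have "\<sigma> x = x" for x using out[of x] by (cases "x = 1"; cases "x = 2") simp_all
    then show ?thesis by (simp add: fun_eq_iff)
  next
    assume "\<sigma> 1 = 2 \<and> \<sigma> 2 = 1"
    then have "\<sigma> x = Transposition.transpose 1 2 x" for x
      using out[of x] by (cases "x = 1"; cases "x = 2") (simp_all add: transpose_def)
    then show ?thesis by (simp add: fun_eq_iff)
  qed
next
  have "Transposition.transpose 1 2 permutes {1, 2::nat}" by (rule permutes_swap_id) simp_all
  moreover assume "\<sigma> = id \<or> \<sigma> = Transposition.transpose 1 2"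
  ultimately show "\<sigma> permutes {1, 2}"
    using permutes_id[of "{1, 2::nat}"] by (elim disjE) (simp_all only:)
qed

lemma has_type_unique:
  assumes "is_profile P"
  shows "\<exists>!t. has_type P t"
proof -
  obtain \<mu> \<omega> where P: "P = (\<mu>, \<omega>)" by fastforce
  have ex: "(\<exists>\<sigma> \<tau>. \<sigma> permutes {1,2} \<and> \<tau> permutes {1,2} \<and> Q \<sigma> \<tau>) \<longleftrightarrow>
      (let s = Transposition.transpose 1 2 in Q id id \<or> Q id s \<or> Q s id \<or> Q s s)"
    for Q :: "(nat \<Rightarrow> nat) \<Rightarrow> (nat \<Rightarrow> nat) \<Rightarrow> bool"
    unfolding permutes_12_iff Let_def by blast
  have one: "\<exists>!t. Q t"
    if "Q t0" "(t0 = TypeA \<or> \<not> Q TypeA) \<and> (t0 = TypeB \<or> \<not> Q TypeB) \<and>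
      (t0 = TypeC \<or> \<not> Q TypeC) \<and> (t0 = TypeD \<or> \<not> Q TypeD)" for Q t0
  proof (rule ex1I[of Q t0, OF that(1)])
    fix t assume "Q t"
    with that(2) show "t = t0" by (cases t) simp_all
  qed
  have two_neq_one: "(2::nat) = 1 \<longleftrightarrow> False" by simp
  note ht = has_type_def[of P, unfolded ex Let_def P]
  note defs = man_prefers_def woman_prefers_def relabel_profile_def interchange_def
    standard_form.simps prod.case fst_conv snd_conv id_apply
    transpose_apply_first transpose_apply_second two_neq_one ptype.distinct simp_thms
  have "bij_betw (\<mu> 1) {1,2} {1,2}" "bij_betw (\<mu> 2) {1,2} {1,2}"
    "bij_betw (\<omega> 1) {1,2} {1,2}" "bij_betw (\<omega> 2) {1,2} {1,2}"
    using assms unfolding is_profile_def P by simp_all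
  then show ?thesis
    unfolding bij_betw_12_iff P
    by (elim disjE conjE)
      (rule one[of _ TypeA], (simp only: ht defs; fail), (simp only: ht defs; fail) |
        rule one[of _ TypeB], (simp only: ht defs; fail), (simp only: ht defs; fail) |
        rule one[of _ TypeC], (simp only: ht defs; fail), (simp only: ht defs; fail) |
        rule one[of _ TypeD], (simp only: ht defs; fail), (simp only: ht defs; fail))+
qed

end

theory Submission
  imports Defs
begin

text \<open>Two facts make the result true.

  Within one Sudoku, the type of a digit is the same information as the shape of the set of positions
  it occupies. Say the digit is at \<open>(i, j)\<close> in the top left box. A row of the grid may not repeat the
  digit, so in the box to the right it is in row \<open>3 - i\<close>; likewise columns fix its column in the box
  below, and the last box is then determined. Hence the digit has positions \<open>(i, j)\<close>, \<open>(3 - i, k)\<close>,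
  \<open>(l, 3 - j)\<close> and \<open>(3 - l, 3 - k)\<close>. The men agree on their first choice iff \<open>j = k\<close>, and the women
  iff \<open>i = l\<close>. If some side agrees (types A and B), the four positions are distinct; if neither does
  (types C and D), the digit only uses two diagonally opposite positions, which form the graph of a
  function. So a Sudoku is disjoint-groups iff all its types are A or B
  (\<open>disjoint_groups_iff\<close>), and joint-groups iff all are C or D (\<open>joint_groups_iff\<close>).

  Up to relabeling, the top left box reads 1 2 / 3 4. The boxes next to it then involve four binary
  choices: \<open>p\<close> and \<open>q\<close> say whether the pairs 3, 4 and 1, 2 are swapped in the rows of the top right
  box, and \<open>r\<close> and \<open>s\<close> whether the pairs 2, 4 and 1, 3 are swapped in the columns of the bottom left
  box. The last box can be completed, and then uniquely, iff \<open>p = q\<close> or \<open>r = s\<close>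
  (\<open>sudoku_eq_normal_grid\<close>, \<open>normal_grid_in_sudokus\<close>), which leaves 16 - 4 = 12 grids, no two of them
  relabelings of each other. Each digit's type depends on one bit per direction: the digits 1, 2, 3, 4
  see the bits \<open>(q, s)\<close>, \<open>(q, r)\<close>, \<open>(p, s)\<close>, \<open>(p, r)\<close>. With no bit set the type is A, with one it is B,
  and with both it is C for the digits 1 and 4 on the diagonal of the first box and D for 2 and 3
  (\<open>types_normal_grid\<close>). Reading off the 12 cases gives the counts.\<close>

section \<open>Types of profiles\<close>

text \<open>Relabeling the women does not affect whether the men agree, and interchanging the roles swaps
  the two agreements, so the number of sides that agree is an invariant; it separates A, B and
  \<open>{C, D}\<close>. If neither side agrees, all preferences are determined by \<open>\<mu> 1 1\<close> and \<open>\<omega> 1 1\<close>, and C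
  and D differ in whether first choices are mutual.\<close>

lemma type_of_eq:
  assumes "is_profile (\<mu>, \<omega>)"
  shows "type_of (\<mu>, \<omega>) =
    (if \<mu> 1 1 = \<mu> 2 1 then if \<omega> 1 1 = \<omega> 2 1 then TypeA else TypeB
     else if \<omega> 1 1 = \<omega> 2 1 then TypeB
     else if \<mu> 1 1 = \<omega> 1 1 then TypeC else TypeD)"
proof -
  have ex: "has_type P t \<longleftrightarrow> (let s = Transposition.transpose 1 2;
      Q = (\<lambda>\<sigma> \<tau>. standard_form t (relabel_profile \<sigma> \<tau> P) \<or>
                   standard_form t (relabel_profile \<sigma> \<tau> (interchange P)))
      in Q id id \<or> Q id s \<or> Q s id \<or> Q s s)" for P t
    unfolding has_type_def permutes_12_iff Let_def by blast
  have one: "type_of (\<mu>, \<omega>) = t" if "has_type (\<mu>, \<omega>) t" for t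
    unfolding type_of_def by (rule the1_equality[OF has_type_unique[OF assms] that])
  have "bij_betw (\<mu> 1) {1,2} {1,2}" "bij_betw (\<mu> 2) {1,2} {1,2}"
    "bij_betw (\<omega> 1) {1,2} {1,2}" "bij_betw (\<omega> 2) {1,2} {1,2}"
    using assms unfolding is_profile_def by simp_all
  then show ?thesis
    unfolding bij_betw_12_iff
    by (elim disjE conjE; intro one)
      (simp_all add: ex Let_def man_prefers_def woman_prefers_def relabel_profile_def
        interchange_def del: One_nat_def)
qed

section \<open>Sudoku conditions as injectivity\<close>

text \<open>A map into a set of the same finite size hits every value exactly once iff it never repeats
  one. This replaces the unique existence conditions on rows, columns and boxes by inequalities
  between entries, which are easier both to verify and to exploit.\<close>

lemma all_ex1_iff_inj_on:
  assumes "finite A" "finite B" "card A = card B" "f ` A \<subseteq> B"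
  shows "(\<forall>d\<in>B. \<exists>!c. c \<in> A \<and> f c = d) \<longleftrightarrow> inj_on f A"
proof
  assume "\<forall>d\<in>B. \<exists>!c. c \<in> A \<and> f c = d"
  with assms(4) show "inj_on f A" unfolding inj_on_def by blast
next
  assume inj: "inj_on f A"
  then have "f ` A = B" using assms by (metis card_image card_subset_eq)
  with inj show "\<forall>d\<in>B. \<exists>!c. c \<in> A \<and> f c = d" unfolding inj_on_def by blast
qed

lemma cell_simps:
  "cell 1 1 (i, j) = (i, j)" "cell 1 2 (i, j) = (i, j + 2)"
  "cell 2 1 (i, j) = (i + 2, j)" "cell 2 2 (i, j) = (i + 2, j + 2)"
  by (simp_all add: cell_def)

lemma cell_in_cells: "w \<in> {1,2} \<Longrightarrow> m \<in> {1,2} \<Longrightarrow> p \<in> {1,2} \<times> {1,2} \<Longrightarrow> cell w m p \<in> cells"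
  by (auto simp: cell_def cells_def)

lemma sudokus_iff:
  "S \<in> sudokus \<longleftrightarrow> S \<in> cells \<rightarrow>\<^sub>E digits \<and>
     (\<forall>r\<in>{1..4}. inj_on (\<lambda>c. S (r, c)) {1..4}) \<and>
     (\<forall>c\<in>{1..4}. inj_on (\<lambda>r. S (r, c)) {1..4}) \<and>
     (\<forall>w\<in>{1,2}. \<forall>m\<in>{1,2}. inj_on (\<lambda>p. S (cell w m p)) ({1,2} \<times> {1,2}))"
proof (cases "S \<in> cells \<rightarrow>\<^sub>E digits")
  case True
  then have S: "S x \<in> digits" if "x \<in> cells" for x using that by (rule PiE_mem)
  have rows: "(\<forall>d\<in>digits. \<exists>!c. c \<in> {1..4} \<and> S (r, c) = d) \<longleftrightarrow> inj_on (\<lambda>c. S (r, c)) {1..4}"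
    if "r \<in> {1..4}" for r
    by (rule all_ex1_iff_inj_on) (use S that in \<open>auto simp: digits_def cells_def\<close>)
  have cols: "(\<forall>d\<in>digits. \<exists>!r. r \<in> {1..4} \<and> S (r, c) = d) \<longleftrightarrow> inj_on (\<lambda>r. S (r, c)) {1..4}"
    if "c \<in> {1..4}" for c
    by (rule all_ex1_iff_inj_on) (use S that in \<open>auto simp: digits_def cells_def\<close>)
  have boxes: "(\<forall>d\<in>digits. \<exists>!p. p \<in> {1,2} \<times> {1,2} \<and> S (cell w m p) = d) \<longleftrightarrow>
      inj_on (\<lambda>p. S (cell w m p)) ({1,2} \<times> {1,2})"
    if "w \<in> {1,2}" "m \<in> {1,2}" for w m
  proof (rule all_ex1_iff_inj_on)
    show "(\<lambda>p. S (cell w m p)) ` ({1,2} \<times> {1,2}) \<subseteq> digits"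
      using S cell_in_cells[OF that] by blast
  qed (simp_all add: digits_def)
  have "S \<in> sudokus \<longleftrightarrow>
      (\<forall>r\<in>{1..4}. \<forall>d\<in>digits. \<exists>!c. c \<in> {1..4} \<and> S (r, c) = d) \<and>
      (\<forall>c\<in>{1..4}. \<forall>d\<in>digits. \<exists>!r. r \<in> {1..4} \<and> S (r, c) = d) \<and>
      (\<forall>w\<in>{1,2}. \<forall>m\<in>{1,2}. \<forall>d\<in>digits. \<exists>!p. p \<in> {1,2} \<times> {1,2} \<and> S (cell w m p) = d)"
    unfolding sudokus_def mem_Collect_eq by (simp only: True simp_thms)
  also have "\<dots> \<longleftrightarrow>
     (\<forall>r\<in>{1..4}. inj_on (\<lambda>c. S (r, c)) {1..4}) \<and>
     (\<forall>c\<in>{1..4}. inj_on (\<lambda>r. S (r, c)) {1..4}) \<and>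
     (\<forall>w\<in>{1,2}. \<forall>m\<in>{1,2}. inj_on (\<lambda>p. S (cell w m p)) ({1,2} \<times> {1,2}))"
    by (intro arg_cong2[of _ _ _ _ "(\<and>)"] ball_cong refl rows cols boxes)
  finally show ?thesis using True by (simp only: simp_thms)
qed (simp add: sudokus_def)

lemma digit_pos_eqI:
  assumes "S \<in> sudokus" "d \<in> digits" "w \<in> {1,2}" "m \<in> {1,2}"
    and "p \<in> {1,2} \<times> {1,2}" "S (cell w m p) = d"
  shows "digit_pos S d w m = p"
  unfolding digit_pos_def using sudokus_ex1(3)[OF assms(1-4)] assms(5,6)
  by (intro the1_equality) simp_all

lemma digit_pos_cell:
  assumes "S \<in> sudokus" "w \<in> {1,2}" "m \<in> {1,2}" "p \<in> {1,2} \<times> {1,2}"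
  shows "S (cell w m p) \<in> digits" "digit_pos S (S (cell w m p)) w m = p"
proof -
  show *: "S (cell w m p) \<in> digits"
    using PiE_mem[OF conjunct1[OF assms(1)[unfolded sudokus_iff]] cell_in_cells[OF assms(2-4)]] .
  show "digit_pos S (S (cell w m p)) w m = p"
    by (rule digit_pos_eqI[OF assms(1) * assms(2-4)]) simp
qed

section \<open>Types and the positions of a digit\<close>

lemma type_of_digit:
  assumes "S \<in> sudokus" "d \<in> digits"
  shows "type_of (digit_profile S d) =
    (if snd (digit_pos S d 1 1) = snd (digit_pos S d 1 2)
     then if fst (digit_pos S d 1 1) = fst (digit_pos S d 2 1) then TypeA else TypeB
     else if fst (digit_pos S d 1 1) = fst (digit_pos S d 2 1) then TypeB
     else if snd (digit_pos S d 1 1) = fst (digit_pos S d 1 1) then TypeC else TypeD)"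
  by (rule type_of_eq[OF is_profile_digit_profile[OF assms, unfolded digit_profile_def],
      folded digit_profile_def])

lemma digit_pos_rule:
  assumes "S \<in> sudokus" "d \<in> digits"
  shows "snd (digit_pos S d 2 1) = 3 - snd (digit_pos S d 1 1)"
    "snd (digit_pos S d 2 2) = 3 - snd (digit_pos S d 1 2)"
    "fst (digit_pos S d 1 2) = 3 - fst (digit_pos S d 1 1)"
    "fst (digit_pos S d 2 2) = 3 - fst (digit_pos S d 2 1)"
proof -
  have "is_profile (digit_profile S d)" by (rule is_profile_digit_profile[OF assms])
  then have "bij_betw (\<lambda>w. snd (digit_pos S d w 1)) {1,2} {1,2}"
    "bij_betw (\<lambda>w. snd (digit_pos S d w 2)) {1,2} {1,2}"
    "bij_betw (\<lambda>m. fst (digit_pos S d 1 m)) {1,2} {1,2}"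
    "bij_betw (\<lambda>m. fst (digit_pos S d 2 m)) {1,2} {1,2}"
    unfolding is_profile_def digit_profile_def by simp_all
  then show "snd (digit_pos S d 2 1) = 3 - snd (digit_pos S d 1 1)"
    "snd (digit_pos S d 2 2) = 3 - snd (digit_pos S d 1 2)"
    "fst (digit_pos S d 1 2) = 3 - fst (digit_pos S d 1 1)"
    "fst (digit_pos S d 2 2) = 3 - fst (digit_pos S d 2 1)"
    unfolding bij_betw_12_iff by auto
qed

text \<open>Of the eight coordinates that locate a digit in the four boxes, four are free: two boxes in one
  band hold the digit in different rows, two boxes in one stack in different columns.\<close>

lemma digit_pos_cases:
  assumes S: "S \<in> sudokus" and d: "d \<in> digits"
  obtains i j k l where "{i, j, k, l} \<subseteq> {1, 2}"
    "digit_pos S d 1 1 = (i, j)" "digit_pos S d 1 2 = (3 - i, k)"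
    "digit_pos S d 2 1 = (l, 3 - j)" "digit_pos S d 2 2 = (3 - l, 3 - k)"
proof
  note m = digit_pos(1)[OF S d, unfolded mem_Times_iff]
  show "{fst (digit_pos S d 1 1), snd (digit_pos S d 1 1), snd (digit_pos S d 1 2),
      fst (digit_pos S d 2 1)} \<subseteq> {1, 2}"
    using m[of 1 1] m[of 1 2] m[of 2 1] by simp
qed (use digit_pos_rule[OF assms] in \<open>simp_all add: prod_eq_iff\<close>)

text \<open>Adjacent boxes always hold the digit at different positions. The opposite boxes coincide only if
  \<open>i = 3 - l\<close> and \<open>j = 3 - k\<close> in the notation of \<open>digit_pos_cases\<close>, that is, if neither side agrees;
  the same condition arises from both diagonals.\<close>

lemma inj_on_digit_pos_iff:
  assumes S: "S \<in> sudokus" and d: "d \<in> digits"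
  shows "inj_on (\<lambda>(w, m). digit_pos S d w m) ({1,2} \<times> {1,2}) \<longleftrightarrow>
    type_of (digit_profile S d) \<in> {TypeA, TypeB}"
proof -
  from digit_pos_cases[OF assms] obtain i j k l where *: "{i, j, k, l} \<subseteq> {1, 2}"
    "digit_pos S d 1 1 = (i, j)" "digit_pos S d 1 2 = (3 - i, k)"
    "digit_pos S d 2 1 = (l, 3 - j)" "digit_pos S d 2 2 = (3 - l, 3 - k)" .
  have "{1,2} \<times> {1,2} = {(1,1), (1,2), (2,1), (2,2::nat)::nat\<times>nat}" by auto
  moreover have "i = 1 \<or> i = 2" "j = 1 \<or> j = 2" "k = 1 \<or> k = 2" "l = 1 \<or> l = 2"
    using *(1) by simp_all
  ultimately show ?thesis
    unfolding type_of_digit[OF assms] *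
    by (elim disjE) (simp_all add: inj_on_insert * del: One_nat_def)
qed

text \<open>If the women agree (\<open>i = l\<close>), row \<open>i\<close> is used with both columns \<open>j\<close> and \<open>3 - j\<close>; if the men agree
  (\<open>j = k\<close>), rows \<open>i\<close> and \<open>3 - i\<close> share a column, so \<open>l\<close>, being one of them, would need the other
  column too. Otherwise only the positions \<open>(i, j)\<close> and \<open>(3 - i, k)\<close> occur.\<close>

lemma digit_pos_function_iff:
  assumes S: "S \<in> sudokus" and d: "d \<in> digits"
  shows "(\<exists>f :: nat \<Rightarrow> nat. \<forall>w\<in>{1,2}. \<forall>m\<in>{1,2}. \<exists>i. digit_pos S d w m = (i, f i)) \<longleftrightarrow>
    type_of (digit_profile S d) \<in> {TypeC, TypeD}"
proof -
  from digit_pos_cases[OF assms] obtain i j k l where *: "{i, j, k, l} \<subseteq> {1, 2}"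
    "digit_pos S d 1 1 = (i, j)" "digit_pos S d 1 2 = (3 - i, k)"
    "digit_pos S d 2 1 = (l, 3 - j)" "digit_pos S d 2 2 = (3 - l, 3 - k)" .
  have "(\<forall>w\<in>{1,2}. \<forall>m\<in>{1,2}. \<exists>i. digit_pos S d w m = (i, f i)) \<longleftrightarrow>
      f i = j \<and> f (3 - i) = k \<and> f l = 3 - j \<and> f (3 - l) = 3 - k" for f :: "nat \<Rightarrow> nat"
    by (auto simp: * simp del: One_nat_def)
  moreover have "(\<exists>f :: nat \<Rightarrow> nat. f i = j \<and> f (3 - i) = k \<and> f l = 3 - j \<and> f (3 - l) = 3 - k)
      \<longleftrightarrow> j \<noteq> k \<and> i \<noteq> l"
  proof
    assume "j \<noteq> k \<and> i \<noteq> l"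
    with *(1) show "\<exists>f :: nat \<Rightarrow> nat. f i = j \<and> f (3 - i) = k \<and> f l = 3 - j \<and> f (3 - l) = 3 - k"
      by (intro exI[of _ "\<lambda>x. if x = i then j else k"]) auto
  next
    assume "\<exists>f :: nat \<Rightarrow> nat. f i = j \<and> f (3 - i) = k \<and> f l = 3 - j \<and> f (3 - l) = 3 - k"
    then obtain f :: "nat \<Rightarrow> nat" where f: "f i = j" "f (3 - i) = k" "f l = 3 - j" "f (3 - l) = 3 - k"
      by blast
    have "l = i \<or> l = 3 - i" using *(1) by auto
    moreover have "j \<noteq> 3 - j" using *(1) by auto
    ultimately have l: "l = 3 - i" using f(1,3) by metis
    then have "k = 3 - j" using f(2,3) by metis
    with l show "j \<noteq> k \<and> i \<noteq> l" using *(1) by auto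
  qed
  ultimately show ?thesis
    unfolding type_of_digit[OF assms] * by auto
qed

lemma set_mset_types: "set_mset (types S) = (\<lambda>d. type_of (digit_profile S d)) ` digits"
  by (simp add: types_def digits_def)

text \<open>Both "no position carries a digit twice" and "no digit has a position twice" say that no
  position and digit coincide in two boxes, so the condition on positions can be checked digit by
  digit.\<close>

lemma disjoint_groups_iff:
  assumes S: "S \<in> sudokus"
  shows "disjoint_groups S \<longleftrightarrow> set_mset (types S) \<subseteq> {TypeA, TypeB}"
proof -
  let ?B = "{1, 2::nat} \<times> {1, 2::nat}"
  have "disjoint_groups S \<longleftrightarrow> (\<forall>d\<in>digits. inj_on (\<lambda>(w, m). digit_pos S d w m) ?B)"
  proof
    assume dj: "disjoint_groups S"
    show "\<forall>d\<in>digits. inj_on (\<lambda>(w, m). digit_pos S d w m) ?B"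
    proof (intro ballI inj_onI, elim SigmaE, hypsubst, unfold prod.case)
      fix d w m w' m' assume d: "d \<in> digits"
        and b: "w \<in> {1,2}" "m \<in> {1,2}" "w' \<in> {1,2}" "m' \<in> {1,2}"
        and eq: "digit_pos S d w m = digit_pos S d w' m'"
      let ?p = "digit_pos S d w m"
      have "S (cell w m ?p) = d" "S (cell w' m' ?p) = d"
        using digit_pos(2)[OF S d b(1,2)] digit_pos(2)[OF S d b(3,4)] unfolding eq .
      moreover have "inj_on (\<lambda>(w, m). S (cell w m ?p)) ?B"
        using dj digit_pos(1)[OF S d b(1,2)] unfolding disjoint_groups_def by (elim conjE bspec)
      ultimately show "(w, m) = (w', m')"
        by (elim inj_onD) (simp_all only: prod.case mem_Sigma_iff b simp_thms)
    qed
  next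
    assume inj: "\<forall>d\<in>digits. inj_on (\<lambda>(w, m). digit_pos S d w m) ?B"
    show "disjoint_groups S" unfolding disjoint_groups_def
    proof (intro conjI[OF S] ballI[of ?B] inj_onI)
      fix p b b' assume p: "p \<in> ?B" and "b \<in> ?B" "b' \<in> ?B"
        and "(\<lambda>(w, m). S (cell w m p)) b = (\<lambda>(w, m). S (cell w m p)) b'"
      then obtain w m w' m' where bb: "b = (w, m)" "b' = (w', m')"
        and b: "w \<in> {1,2}" "m \<in> {1,2}" "w' \<in> {1,2}" "m' \<in> {1,2}"
        and eq: "S (cell w m p) = S (cell w' m' p)"
        by (elim SigmaE) (simp only: prod.case)
      let ?d = "S (cell w m p)"
      have "digit_pos S ?d w m = p"
        by (rule digit_pos_cell[OF S b(1,2) p])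
      moreover have "digit_pos S ?d w' m' = p"
        unfolding eq by (rule digit_pos_cell[OF S b(3,4) p])
      moreover have "inj_on (\<lambda>(w, m). digit_pos S ?d w m) ?B"
        using inj digit_pos_cell(1)[OF S b(1,2) p] by (rule bspec)
      ultimately show "b = b'" unfolding bb
        by (elim inj_onD) (simp_all only: prod.case mem_Sigma_iff b simp_thms)
    qed
  qed
  also have "\<dots> \<longleftrightarrow> set_mset (types S) \<subseteq> {TypeA, TypeB}"
    unfolding set_mset_types image_subset_iff by (intro ball_cong refl inj_on_digit_pos_iff S)
  finally show ?thesis .
qed

lemma joint_groups_iff:
  assumes S: "S \<in> sudokus"
  shows "joint_groups S \<longleftrightarrow> set_mset (types S) \<subseteq> {TypeC, TypeD}"
  unfolding joint_groups_def set_mset_types image_subset_iff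
  using S digit_pos_function_iff[OF S] by simp

section \<open>Relabeling\<close>

lemma relabel_in_sudokus:
  assumes S: "S \<in> sudokus" and \<pi>: "\<pi> permutes digits"
  shows "restrict (\<pi> \<circ> S) cells \<in> sudokus"
proof -
  have S': "S \<in> cells \<rightarrow>\<^sub>E digits" using S unfolding sudokus_iff by blast
  have "inj \<pi>" using \<pi> by (rule permutes_inj)
  then have *: "inj_on (\<lambda>x. restrict (\<pi> \<circ> S) cells (g x)) A" if "inj_on (\<lambda>x. S (g x)) A"
    "g ` A \<subseteq> cells" for g :: "'a \<Rightarrow> nat \<times> nat" and A
    using that unfolding inj_on_def by (auto simp: image_subset_iff)
  note inj = S[unfolded sudokus_iff, THEN conjunct2, THEN conjunct1]
    S[unfolded sudokus_iff, THEN conjunct2, THEN conjunct2, THEN conjunct1]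
    S[unfolded sudokus_iff, THEN conjunct2, THEN conjunct2, THEN conjunct2]
  show ?thesis unfolding sudokus_iff
  proof (intro conjI ballI *)
    show "restrict (\<pi> \<circ> S) cells \<in> cells \<rightarrow>\<^sub>E digits"
      using S' permutes_in_image[OF \<pi>] by (auto simp: PiE_iff)
  next
    fix r :: nat assume r: "r \<in> {1..4}"
    show "inj_on (\<lambda>c. S (r, c)) {1..4}" by (rule bspec[OF inj(1) r])
    show "Pair r ` {1..4} \<subseteq> cells" using r by (auto simp: cells_def)
  next
    fix c :: nat assume c: "c \<in> {1..4}"
    show "inj_on (\<lambda>r. S (r, c)) {1..4}" by (rule bspec[OF inj(2) c])
    show "(\<lambda>r. (r, c)) ` {1..4} \<subseteq> cells" using c by (auto simp: cells_def)
  next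
    fix w m :: nat assume wm: "w \<in> {1,2}" "m \<in> {1,2}"
    show "inj_on (\<lambda>p. S (cell w m p)) ({1,2} \<times> {1,2})"
      by (rule bspec[OF bspec[OF inj(3) wm(1)] wm(2)])
    show "cell w m ` ({1,2} \<times> {1,2}) \<subseteq> cells" using cell_in_cells[OF wm] by blast
  qed
qed

lemma equiv_relabeling: "equiv sudokus relabeling"
proof (rule equivI)
  show "relabeling \<subseteq> sudokus \<times> sudokus" by (auto simp: relabeling_def)
  show "refl_on sudokus relabeling"
    by (auto simp: refl_on_def relabeling_def intro!: exI[of _ id] permutes_id)
  show "sym relabeling"
  proof (rule symI)
    fix S T assume "(S, T) \<in> relabeling"
    then obtain \<pi> where *: "S \<in> sudokus" "T \<in> sudokus" "\<pi> permutes digits"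
      "\<forall>x\<in>cells. T x = \<pi> (S x)" unfolding relabeling_def by blast
    then have "\<forall>x\<in>cells. S x = inv \<pi> (T x)" by (simp add: permutes_inverses)
    with * permutes_inv[OF *(3)] show "(T, S) \<in> relabeling" unfolding relabeling_def by blast
  qed
  show "trans relabeling"
  proof (rule transI)
    fix S T U assume "(S, T) \<in> relabeling" "(T, U) \<in> relabeling"
    then obtain \<pi> \<rho> where *: "S \<in> sudokus" "U \<in> sudokus" "\<pi> permutes digits" "\<rho> permutes digits"
      "\<forall>x\<in>cells. T x = \<pi> (S x)" "\<forall>x\<in>cells. U x = \<rho> (T x)" unfolding relabeling_def by blast
    then have "\<forall>x\<in>cells. U x = (\<rho> \<circ> \<pi>) (S x)" by simp
    with * permutes_compose[OF *(3,4)] show "(S, U) \<in> relabeling" unfolding relabeling_def by blast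
  qed
qed

text \<open>A relabeling moves digits without moving positions, so it permutes the four profiles among the
  digits.\<close>

lemma types_relabeling:
  assumes "(S, T) \<in> relabeling"
  shows "types T = types S"
proof -
  from assms obtain \<pi> where *: "S \<in> sudokus" "T \<in> sudokus" and \<pi>: "\<pi> permutes digits"
    and T: "\<forall>x\<in>cells. T x = \<pi> (S x)" unfolding relabeling_def by blast
  have \<pi>d: "\<pi> d \<in> digits" if "d \<in> digits" for d using that permutes_in_image[OF \<pi>] by simp
  have pos: "digit_pos T (\<pi> d) w m = digit_pos S d w m"
    if "d \<in> digits" "w \<in> {1,2}" "m \<in> {1,2}" for d w m
    using digit_pos[OF *(1) that] that T cell_in_cells[OF that(2,3)]
    by (intro digit_pos_eqI * \<pi>d) auto
  have "type_of (digit_profile T (\<pi> d)) = type_of (digit_profile S d)" if "d \<in> digits" for d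
    using that by (simp add: type_of_digit * \<pi>d pos del: One_nat_def)
  moreover have "mset_set digits = image_mset \<pi> (mset_set digits)"
    using \<pi> by (simp add: image_mset_mset_set permutes_inj_on permutes_image)
  ultimately show ?thesis unfolding types_def
    by (metis (mono_tags, lifting) elem_mset_set digits_def finite_atLeastAtMost multiset.map_comp
        multiset.map_cong comp_apply)
qed

section \<open>Normal forms\<close>

text \<open>The entries of the last box come from the rule that, if the digit is in row \<open>i\<close> of the bottom
  left box and in column \<open>j\<close> of the top right box, it is at \<open>(3 - i, 3 - j)\<close> in the last one: digit 1
  is there governed by \<open>(q, s)\<close>, digit 2 by \<open>(q, r)\<close>, digit 3 by \<open>(p, s)\<close>, and digit 4 takes the place
  that remains.\<close>

definition normal_grid :: "bool \<times> bool \<times> bool \<times> bool \<Rightarrow> grid" where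
  "normal_grid = (\<lambda>(p, q, r, s). \<lambda>(i, j)\<in>cells.
     [[1, 2, if p then 4 else 3, if p then 3 else 4],
      [3, 4, if q then 2 else 1, if q then 1 else 2],
      [if r then 4 else 2, if s then 3 else 1,
       if q \<and> s then 1 else if \<not> q \<and> r then 2 else if p \<and> \<not> s then 3 else 4,
       if \<not> q \<and> s then 1 else if q \<and> r then 2 else if \<not> p \<and> \<not> s then 3 else 4],
      [if r then 2 else 4, if s then 1 else 3,
       if q \<and> \<not> s then 1 else if \<not> q \<and> \<not> r then 2 else if p \<and> s then 3 else 4,
       if \<not> q \<and> \<not> s then 1 else if q \<and> \<not> r then 2 else if \<not> p \<and> s then 3 else 4]]
     ! (i - 1) ! (j - 1))"

definition normal_params :: "(bool \<times> bool \<times> bool \<times> bool) set" where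
  "normal_params = {(p, q, r, s). p = q \<or> r = s}"

lemma nat_1_to_4: "{1..4} = {1, 2, 3, 4::nat}"
  by auto

lemma box_positions: "{1, 2} \<times> {1, 2} = {(1, 1), (1, 2), (2, 1), (2::nat, 2::nat)}"
  by auto

lemma cells_eq: "cells =
  {(1,1), (1,2), (1,3), (1,4), (2,1), (2,2), (2,3), (2,4),
   (3,1), (3,2), (3,3), (3,4), (4,1), (4,2), (4,3), (4,4)}"
  unfolding cells_def nat_1_to_4 by auto

lemma normal_grid_simps:
  "normal_grid (p, q, r, s) (1, 1) = 1"
  "normal_grid (p, q, r, s) (1, 2) = 2"
  "normal_grid (p, q, r, s) (1, 3) = (if p then 4 else 3)"
  "normal_grid (p, q, r, s) (1, 4) = (if p then 3 else 4)"
  "normal_grid (p, q, r, s) (2, 1) = 3"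
  "normal_grid (p, q, r, s) (2, 2) = 4"
  "normal_grid (p, q, r, s) (2, 3) = (if q then 2 else 1)"
  "normal_grid (p, q, r, s) (2, 4) = (if q then 1 else 2)"
  "normal_grid (p, q, r, s) (3, 1) = (if r then 4 else 2)"
  "normal_grid (p, q, r, s) (3, 2) = (if s then 3 else 1)"
  "normal_grid (p, q, r, s) (3, 3) =
    (if q \<and> s then 1 else if \<not> q \<and> r then 2 else if p \<and> \<not> s then 3 else 4)"
  "normal_grid (p, q, r, s) (3, 4) =
    (if \<not> q \<and> s then 1 else if q \<and> r then 2 else if \<not> p \<and> \<not> s then 3 else 4)"
  "normal_grid (p, q, r, s) (4, 1) = (if r then 2 else 4)"
  "normal_grid (p, q, r, s) (4, 2) = (if s then 1 else 3)"
  "normal_grid (p, q, r, s) (4, 3) =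
    (if q \<and> \<not> s then 1 else if \<not> q \<and> \<not> r then 2 else if p \<and> s then 3 else 4)"
  "normal_grid (p, q, r, s) (4, 4) =
    (if \<not> q \<and> \<not> s then 1 else if q \<and> \<not> r then 2 else if \<not> p \<and> s then 3 else 4)"
  by (simp_all add: normal_grid_def cells_def split del: if_split)

lemma normal_grid_in_sudokus:
  assumes "v \<in> normal_params"
  shows "normal_grid v \<in> sudokus"
proof -
  obtain p q r s where v: "v = (p, q, r, s)" by (metis surj_pair)
  have "p = q \<or> r = s" using assms by (simp add: v normal_params_def)
  moreover have "normal_grid v \<in> extensional cells"
    by (simp only: v normal_grid_def prod.case restrict_extensional)
  ultimately show ?thesis
    unfolding sudokus_iff box_positions nat_1_to_4 v cells_eq digits_def PiE_iff ball_simps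
    by (cases p; cases q; cases r; cases s)
      (simp_all add: normal_grid_simps cell_def inj_on_insert del: One_nat_def)
qed

text \<open>The bits are read off from the boxes next to the first. Each entry of the last box must avoid
  two digits in its row and two in its column. If \<open>p = q\<close> or \<open>r = s\<close>, these four entries comprise
  exactly three digits and force the value; otherwise two of the four places see all four digits.\<close>

lemma sudoku_eq_normal_grid:
  assumes S: "S \<in> sudokus"
    and box: "S (1, 1) = 1" "S (1, 2) = 2" "S (2, 1) = 3" "S (2, 2) = 4"
  obtains v where "v \<in> normal_params" "S = normal_grid v"
proof -
  have ext: "S \<in> cells \<rightarrow>\<^sub>E digits" using S unfolding sudokus_iff by (rule conjunct1)
  have val: "S (i, j) \<in> {1, 2, 3, 4}" if "i \<in> {1..4}" "j \<in> {1..4}" for i j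
    using PiE_mem[OF ext, of "(i, j)"] that
    unfolding cells_def digits_def nat_1_to_4 mem_Sigma_iff by blast
  have row: "S (i, j) \<noteq> S (i, j')" if "i \<in> {1..4}" "j \<in> {1..4}" "j' \<in> {1..4}" "j \<noteq> j'" for i j j'
  proof -
    have "inj_on (\<lambda>c. S (i, c)) {1..4}" using S that(1) unfolding sudokus_iff by (elim conjE bspec)
    with that show ?thesis unfolding inj_on_def by metis
  qed
  have col: "S (i, j) \<noteq> S (i', j)" if "j \<in> {1..4}" "i \<in> {1..4}" "i' \<in> {1..4}" "i \<noteq> i'" for i i' j
  proof -
    have "inj_on (\<lambda>r. S (r, j)) {1..4}" using S that(1) unfolding sudokus_iff by (elim conjE bspec)
    with that show ?thesis unfolding inj_on_def by metis
  qed
  define p q r s where defs: "p \<longleftrightarrow> S (1, 3) = 4" "q \<longleftrightarrow> S (2, 3) = 2"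
    "r \<longleftrightarrow> S (3, 1) = 4" "s \<longleftrightarrow> S (3, 2) = 3"
  have top: "S (1, 3) = (if p then 4 else 3)" "S (1, 4) = (if p then 3 else 4)"
    using val[of 1 3] val[of 1 4] row[of 1 1 3] row[of 1 2 3] row[of 1 1 4] row[of 1 2 4] row[of 1 3 4]
    unfolding defs box by auto
  have snd_row: "S (2, 3) = (if q then 2 else 1)" "S (2, 4) = (if q then 1 else 2)"
    using val[of 2 3] val[of 2 4] row[of 2 1 3] row[of 2 2 3] row[of 2 1 4] row[of 2 2 4] row[of 2 3 4]
    unfolding defs box by auto
  have fst_col: "S (3, 1) = (if r then 4 else 2)" "S (4, 1) = (if r then 2 else 4)"
    using val[of 3 1] val[of 4 1] col[of 1 1 3] col[of 1 2 3] col[of 1 1 4] col[of 1 2 4] col[of 1 3 4]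
    unfolding defs box by auto
  have snd_col: "S (3, 2) = (if s then 3 else 1)" "S (4, 2) = (if s then 1 else 3)"
    using val[of 3 2] val[of 4 2] col[of 2 1 3] col[of 2 2 3] col[of 2 1 4] col[of 2 2 4] col[of 2 3 4]
    unfolding defs box by auto
  note outer = top snd_row fst_col snd_col
  have rest: "S (i, j) \<in> {1, 2, 3, 4} - {S (i, 1), S (i, 2), S (1, j), S (2, j)}"
    if "i \<in> {3, 4}" "j \<in> {3, 4}" for i j
    using that val[of i j] row[of i j 1] row[of i j 2] col[of j i 1] col[of j i 2] by auto
  note inner = rest[of 3 3] rest[of 3 4] rest[of 4 3] rest[of 4 4]
  have params: "p = q \<or> r = s"
    using inner unfolding outer by (cases p; cases q; cases r; cases s) simp_all
  have "S (3, 3) = normal_grid (p, q, r, s) (3, 3)" "S (3, 4) = normal_grid (p, q, r, s) (3, 4)"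
    "S (4, 3) = normal_grid (p, q, r, s) (4, 3)" "S (4, 4) = normal_grid (p, q, r, s) (4, 4)"
    using params inner unfolding outer normal_grid_simps
    by (cases p; cases q; cases r; cases s; simp; fail)+
  then have "S x = normal_grid (p, q, r, s) x" if "x \<in> cells" for x
    using that box outer unfolding cells_eq insert_iff empty_iff
    by (elim disjE) (simp_all only: normal_grid_simps(1-10,13,14))
  moreover have "S x = normal_grid (p, q, r, s) x" if "x \<notin> cells" for x
    using that PiE_arb[OF ext] by (simp add: normal_grid_def)
  ultimately have "S = normal_grid (p, q, r, s)" by blast
  moreover have "(p, q, r, s) \<in> normal_params" using params by (simp add: normal_params_def)
  ultimately show ?thesis by (rule that[rotated])
qed

text \<open>All normal grids share the first box, which contains every digit, so only the identity can relate
  them.\<close>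

lemma relabeling_normal_grid_eq:
  assumes "(normal_grid v, normal_grid v') \<in> relabeling"
  shows "v = v'"
proof -
  obtain p q r s p' q' r' s' where v: "v = (p, q, r, s)" "v' = (p', q', r', s')"
    by (metis surj_pair)
  obtain \<pi> where \<pi>: "\<forall>x\<in>cells. normal_grid v' x = \<pi> (normal_grid v x)"
    using assms unfolding relabeling_def by blast
  note eq = \<pi>[unfolded v, rule_format]
  have fix_digits: "\<pi> 1 = 1" "\<pi> 2 = 2" "\<pi> 3 = 3" "\<pi> 4 = 4"
    using eq[of "(1,1)"] eq[of "(1,2)"] eq[of "(2,1)"] eq[of "(2,2)"]
    by (simp_all add: cells_eq normal_grid_simps del: One_nat_def)
  have "p = p'" "q = q'" "r = r'" "s = s'"
    using eq[of "(1,3)"] eq[of "(2,3)"] eq[of "(3,1)"] eq[of "(3,2)"]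
    by (simp_all add: cells_eq normal_grid_simps fix_digits if_distrib[of \<pi>] del: One_nat_def
        split: if_splits)
  then show ?thesis by (simp add: v)
qed

text \<open>The relabeling sends each digit to the number, in reading order, of its place in the first
  box.\<close>

lemma relabeling_to_normal_grid:
  assumes S: "S \<in> sudokus"
  obtains v where "v \<in> normal_params" "(S, normal_grid v) \<in> relabeling"
proof -
  (* reading order: (1,1), (1,2), (2,1), (2,2) become 1, 2, 3, 4 *)
  define n :: "nat \<times> nat \<Rightarrow> nat" where "n = (\<lambda>(i, j). 2 * (i - 1) + j)"
  define \<pi> where "\<pi> d = (if d \<in> digits then n (digit_pos S d 1 1) else d)" for d
  have n_range: "n p \<in> digits" if "p \<in> {1,2} \<times> {1,2}" for p
    using that by (auto simp: n_def digits_def)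
  have n_inj: "inj_on n ({1,2} \<times> {1,2})"
    by (simp add: box_positions n_def inj_on_insert)
  have "inj_on \<pi> digits"
  proof (rule inj_onI)
    fix d d' assume d: "d \<in> digits" and d': "d' \<in> digits" and "\<pi> d = \<pi> d'"
    then have "n (digit_pos S d 1 1) = n (digit_pos S d' 1 1)" unfolding \<pi>_def by simp
    then have "digit_pos S d 1 1 = digit_pos S d' 1 1"
      by (rule inj_onD[OF n_inj]) (intro digit_pos(1) S d d' insertI1)+
    then show "d = d'"
      using digit_pos(2)[OF S d, of 1 1] digit_pos(2)[OF S d', of 1 1] by simp
  qed
  moreover have "\<pi> ` digits \<subseteq> digits"
  proof (rule image_subsetI)
    fix d assume d: "d \<in> digits"
    have "n (digit_pos S d 1 1) \<in> digits"
      by (rule n_range) (rule digit_pos(1)[OF S d insertI1 insertI1])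
    with d show "\<pi> d \<in> digits" by (simp only: \<pi>_def if_True)
  qed
  ultimately have "bij_betw \<pi> digits digits"
    unfolding bij_betw_def by (simp add: endo_inj_surj digits_def)
  then have perm: "\<pi> permutes digits"
    by (rule bij_imp_permutes) (simp add: \<pi>_def)
  define T where "T = restrict (\<pi> \<circ> S) cells"
  have T: "T \<in> sudokus" unfolding T_def by (rule relabel_in_sudokus[OF S perm])
  have rel: "(S, T) \<in> relabeling" unfolding relabeling_def using S T perm by (auto simp: T_def)
  have "T (cell 1 1 p) = n p" if "p \<in> {1,2} \<times> {1,2}" for p
    using digit_pos_cell[OF S insertI1 insertI1 that] cell_in_cells[OF insertI1 insertI1 that]
    by (simp only: T_def \<pi>_def restrict_apply' comp_apply if_True)
  from this[of "(1,1)"] this[of "(1,2)"] this[of "(2,1)"] this[of "(2,2)"]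
  have "T (1, 1) = 1" "T (1, 2) = 2" "T (2, 1) = 3" "T (2, 2) = 4"
    by (simp_all add: cell_simps n_def del: One_nat_def)
  with T obtain v where "v \<in> normal_params" "T = normal_grid v" by (rule sudoku_eq_normal_grid)
  with rel that show ?thesis by simp
qed

text \<open>The digits 1, 2 are placed in the top right box according to \<open>q\<close> and 3, 4 according to \<open>p\<close>; the
  digits 1, 3 are placed in the bottom left box according to \<open>s\<close> and 2, 4 according to \<open>r\<close>. A set bit
  means that the corresponding side disagrees.\<close>

lemma types_normal_grid:
  assumes "(p, q, r, s) \<in> normal_params"
  shows "types (normal_grid (p, q, r, s)) =
   {# if q \<and> s then TypeC else if q \<or> s then TypeB else TypeA,
      if q \<and> r then TypeD else if q \<or> r then TypeB else TypeA,
      if p \<and> s then TypeD else if p \<or> s then TypeB else TypeA,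
      if p \<and> r then TypeC else if p \<or> r then TypeB else TypeA #}"
proof -
  let ?N = "normal_grid (p, q, r, s)"
  have N: "?N \<in> sudokus" by (rule normal_grid_in_sudokus[OF assms])
  have d: "1 \<in> digits" "2 \<in> digits" "3 \<in> digits" "4 \<in> digits" by (simp_all add: digits_def)
  have pos:
    "digit_pos ?N 1 1 1 = (1, 1)" "digit_pos ?N 1 1 2 = (2, if q then 2 else 1)"
    "digit_pos ?N 1 2 1 = (if s then 2 else 1, 2)"
    "digit_pos ?N 2 1 1 = (1, 2)" "digit_pos ?N 2 1 2 = (2, if q then 1 else 2)"
    "digit_pos ?N 2 2 1 = (if r then 2 else 1, 1)"
    "digit_pos ?N 3 1 1 = (2, 1)" "digit_pos ?N 3 1 2 = (1, if p then 2 else 1)"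
    "digit_pos ?N 3 2 1 = (if s then 1 else 2, 2)"
    "digit_pos ?N 4 1 1 = (2, 2)" "digit_pos ?N 4 1 2 = (1, if p then 1 else 2)"
    "digit_pos ?N 4 2 1 = (if r then 1 else 2, 1)"
    by (rule digit_pos_eqI[OF N]; simp add: d cell_simps normal_grid_simps del: One_nat_def)+
  have "types ?N = {# type_of (digit_profile ?N 1), type_of (digit_profile ?N 2),
      type_of (digit_profile ?N 3), type_of (digit_profile ?N 4) #}"
    by (simp add: types_def digits_def nat_1_to_4 del: One_nat_def)
  also have "type_of (digit_profile ?N 1) =
      (if q \<and> s then TypeC else if q \<or> s then TypeB else TypeA)"
    unfolding type_of_digit[OF N d(1)] pos fst_conv snd_conv by simp
  also have "type_of (digit_profile ?N 2) =
      (if q \<and> r then TypeD else if q \<or> r then TypeB else TypeA)"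
    unfolding type_of_digit[OF N d(2)] pos fst_conv snd_conv by simp
  also have "type_of (digit_profile ?N 3) =
      (if p \<and> s then TypeD else if p \<or> s then TypeB else TypeA)"
    unfolding type_of_digit[OF N d(3)] pos fst_conv snd_conv by simp
  also have "type_of (digit_profile ?N 4) =
      (if p \<and> r then TypeC else if p \<or> r then TypeB else TypeA)"
    unfolding type_of_digit[OF N d(4)] pos fst_conv snd_conv by simp
  finally show ?thesis .
qed

section \<open>Counting\<close>

lemma bij_betw_normal_params_classes:
  "bij_betw (\<lambda>v. relabeling `` {normal_grid v}) normal_params (sudokus // relabeling)"
  unfolding bij_betw_def
proof
  show "inj_on (\<lambda>v. relabeling `` {normal_grid v}) normal_params"
    using relabeling_normal_grid_eq
      eq_equiv_class[OF _ equiv_relabeling normal_grid_in_sudokus] by (blast intro: inj_onI)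
  show "(\<lambda>v. relabeling `` {normal_grid v}) ` normal_params = sudokus // relabeling"
  proof
    show "(\<lambda>v. relabeling `` {normal_grid v}) ` normal_params \<subseteq> sudokus // relabeling"
      using normal_grid_in_sudokus by (blast intro: quotientI)
    show "sudokus // relabeling \<subseteq> (\<lambda>v. relabeling `` {normal_grid v}) ` normal_params"
    proof
      fix K assume "K \<in> sudokus // relabeling"
      then obtain S where S: "S \<in> sudokus" "K = relabeling `` {S}" by (rule quotientE)
      from S(1) obtain v where "v \<in> normal_params" "(S, normal_grid v) \<in> relabeling"
        by (rule relabeling_to_normal_grid)
      with S(2) equiv_class_eq[OF equiv_relabeling]
      show "K \<in> (\<lambda>v. relabeling `` {normal_grid v}) ` normal_params" by blast
    qed
  qed
qed

text \<open>The multiset of types is constant on a class, so it can be evaluated at the normal grid. A sum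
  over the twelve parameters, unlike the cardinality of a filtered set, is evaluated by rewriting.\<close>

lemma card_classes_of_types:
  "card {K \<in> sudokus // relabeling. \<forall>S\<in>K. types S = M} =
    (\<Sum>v\<in>normal_params. if types (normal_grid v) = M then 1 else 0)"
proof -
  let ?K = "\<lambda>v. relabeling `` {normal_grid v}"
  have class_types: "(\<forall>S\<in>?K v. types S = M) \<longleftrightarrow> types (normal_grid v) = M" if "v \<in> normal_params" for v
  proof
    assume "\<forall>S\<in>?K v. types S = M"
    then show "types (normal_grid v) = M"
      by (rule bspec) (rule equiv_class_self[OF equiv_relabeling normal_grid_in_sudokus[OF that]])
  next
    assume M: "types (normal_grid v) = M"
    show "\<forall>S\<in>?K v. types S = M"
    proof
      fix S assume "S \<in> ?K v"
      then have "(normal_grid v, S) \<in> relabeling" by (rule ImageE) simp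
      then show "types S = M" unfolding M[symmetric] by (rule types_relabeling)
    qed
  qed
  have "{K \<in> sudokus // relabeling. \<forall>S\<in>K. types S = M} =
      ?K ` {v \<in> normal_params. \<forall>S\<in>?K v. types S = M}"
    unfolding bij_betw_imp_surj_on[OF bij_betw_normal_params_classes, symmetric]
    by (rule Compr_image_eq)
  also have "{v \<in> normal_params. \<forall>S\<in>?K v. types S = M} =
      {v \<in> normal_params. types (normal_grid v) = M}"
    by (intro Collect_cong conj_cong refl class_types)
  finally have "{K \<in> sudokus // relabeling. \<forall>S\<in>K. types S = M} =
      ?K ` {v \<in> normal_params. types (normal_grid v) = M}" .
  moreover have "inj_on ?K {v \<in> normal_params. types (normal_grid v) = M}"
    using bij_betw_imp_inj_on[OF bij_betw_normal_params_classes] by (rule inj_on_subset) blast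
  ultimately have "card {K \<in> sudokus // relabeling. \<forall>S\<in>K. types S = M} =
      card {v \<in> normal_params. types (normal_grid v) = M}"
    by (simp add: card_image)
  also have "\<dots> = (\<Sum>v\<in>normal_params. if types (normal_grid v) = M then 1 else 0)"
    by (subst card_eq_sum, rule sum.inter_filter) simp
  finally show ?thesis .
qed

text \<open>Comparing multiplicities decides equality of multisets regardless of the order in which their
  elements are listed.\<close>

lemma ptype_multiset_eq_iff:
  "M = N \<longleftrightarrow> count M TypeA = count N TypeA \<and> count M TypeB = count N TypeB \<and>
     count M TypeC = count N TypeC \<and> count M TypeD = count N TypeD"
proof
  assume counts: "count M TypeA = count N TypeA \<and> count M TypeB = count N TypeB \<and>
     count M TypeC = count N TypeC \<and> count M TypeD = count N TypeD"
  show "M = N"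
  proof (rule multiset_eqI)
    fix t show "count M t = count N t" using counts by (cases t) simp_all
  qed
qed simp

lemma normal_params_eq: "normal_params =
  {(False, False, False, False), (False, False, False, True),
   (False, False, True, False), (False, False, True, True),
   (True, True, False, False), (True, True, False, True),
   (True, True, True, False), (True, True, True, True),
   (False, True, False, False), (False, True, True, True),
   (True, False, False, False), (True, False, True, True)}"
proof (rule set_eqI, clarify)
  fix p q r s
  show "(p, q, r, s) \<in> normal_params \<longleftrightarrow> (p, q, r, s) \<in>
    {(False, False, False, False), (False, False, False, True),
     (False, False, True, False), (False, False, True, True),
     (True, True, False, False), (True, True, False, True),
     (True, True, True, False), (True, True, True, True),
     (False, True, False, False), (False, True, True, True),
     (True, False, False, False), (True, False, True, True)}"
    by (cases p; cases q; cases r; cases s) (simp_all add: normal_params_def)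
qed

lemma types_normal_grid_table:
  "types (normal_grid (False, False, False, False)) = {#TypeA, TypeA, TypeA, TypeA#}"
  "types (normal_grid (False, False, False, True)) = {#TypeA, TypeA, TypeB, TypeB#}"
  "types (normal_grid (False, False, True, False)) = {#TypeA, TypeA, TypeB, TypeB#}"
  "types (normal_grid (False, False, True, True)) = {#TypeB, TypeB, TypeB, TypeB#}"
  "types (normal_grid (True, True, False, False)) = {#TypeB, TypeB, TypeB, TypeB#}"
  "types (normal_grid (True, True, False, True)) = {#TypeB, TypeB, TypeC, TypeD#}"
  "types (normal_grid (True, True, True, False)) = {#TypeB, TypeB, TypeC, TypeD#}"
  "types (normal_grid (True, True, True, True)) = {#TypeC, TypeC, TypeD, TypeD#}"
  "types (normal_grid (False, True, False, False)) = {#TypeA, TypeA, TypeB, TypeB#}"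
  "types (normal_grid (False, True, True, True)) = {#TypeB, TypeB, TypeC, TypeD#}"
  "types (normal_grid (True, False, False, False)) = {#TypeA, TypeA, TypeB, TypeB#}"
  "types (normal_grid (True, False, True, True)) = {#TypeB, TypeB, TypeC, TypeD#}"
  by (simp_all add: types_normal_grid normal_params_def ptype_multiset_eq_iff)

theorem mainTheorem6:
  shows "card (sudokus // relabeling) = 12 \<and>
    card {K \<in> sudokus // relabeling. \<forall>S\<in>K. types S = {#TypeA, TypeA, TypeA, TypeA#}} = 1 \<and>
    card {K \<in> sudokus // relabeling. \<forall>S\<in>K. types S = {#TypeA, TypeA, TypeB, TypeB#}} = 4 \<and>
    card {K \<in> sudokus // relabeling. \<forall>S\<in>K. types S = {#TypeB, TypeB, TypeB, TypeB#}} = 2 \<and>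
    card {K \<in> sudokus // relabeling. \<forall>S\<in>K. types S = {#TypeB, TypeB, TypeC, TypeD#}} = 4 \<and>
    card {K \<in> sudokus // relabeling. \<forall>S\<in>K. types S = {#TypeC, TypeC, TypeD, TypeD#}} = 1 \<and>
    (\<forall>S\<in>sudokus. types S \<in> {{#TypeA, TypeA, TypeA, TypeA#}, {#TypeA, TypeA, TypeB, TypeB#}, {#TypeB, TypeB, TypeB, TypeB#},
                             {#TypeB, TypeB, TypeC, TypeD#}, {#TypeC, TypeC, TypeD, TypeD#}}) \<and>
    (\<forall>S\<in>sudokus.
      (types S \<in> {{#TypeA, TypeA, TypeA, TypeA#}, {#TypeA, TypeA, TypeB, TypeB#}, {#TypeB, TypeB, TypeB, TypeB#}} \<longrightarrow> disjoint_groups S) \<and>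
      (types S = {#TypeC, TypeC, TypeD, TypeD#} \<longrightarrow> joint_groups S) \<and>
      (types S = {#TypeB, TypeB, TypeC, TypeD#} \<longrightarrow> \<not> disjoint_groups S \<and> \<not> joint_groups S))"
proof (intro conjI ballI)
  show "card (sudokus // relabeling) = 12"
    using bij_betw_same_card[OF bij_betw_normal_params_classes]
    by (simp add: normal_params_eq)
  show "card {K \<in> sudokus // relabeling. \<forall>S\<in>K. types S = {#TypeA, TypeA, TypeA, TypeA#}} = 1"
    "card {K \<in> sudokus // relabeling. \<forall>S\<in>K. types S = {#TypeA, TypeA, TypeB, TypeB#}} = 4"
    "card {K \<in> sudokus // relabeling. \<forall>S\<in>K. types S = {#TypeB, TypeB, TypeB, TypeB#}} = 2"
    "card {K \<in> sudokus // relabeling. \<forall>S\<in>K. types S = {#TypeB, TypeB, TypeC, TypeD#}} = 4"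
    "card {K \<in> sudokus // relabeling. \<forall>S\<in>K. types S = {#TypeC, TypeC, TypeD, TypeD#}} = 1"
    unfolding card_classes_of_types normal_params_eq
    by (simp_all add: types_normal_grid_table, simp_all add: ptype_multiset_eq_iff)
next
  fix S assume S: "S \<in> sudokus"
  then obtain v where v: "v \<in> normal_params" and "(S, normal_grid v) \<in> relabeling"
    by (rule relabeling_to_normal_grid)
  then have "types S = types (normal_grid v)" using types_relabeling by metis
  then show "types S \<in> {{#TypeA, TypeA, TypeA, TypeA#}, {#TypeA, TypeA, TypeB, TypeB#},
      {#TypeB, TypeB, TypeB, TypeB#}, {#TypeB, TypeB, TypeC, TypeD#}, {#TypeC, TypeC, TypeD, TypeD#}}"
    using v unfolding normal_params_eq insert_iff empty_iff
    by (elim disjE) (simp_all only: types_normal_grid_table simp_thms)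
next
  fix S assume S: "S \<in> sudokus"
  show "types S \<in> {{#TypeA, TypeA, TypeA, TypeA#}, {#TypeA, TypeA, TypeB, TypeB#},
      {#TypeB, TypeB, TypeB, TypeB#}} \<longrightarrow> disjoint_groups S"
    "types S = {#TypeC, TypeC, TypeD, TypeD#} \<longrightarrow> joint_groups S"
    "types S = {#TypeB, TypeB, TypeC, TypeD#} \<longrightarrow> \<not> disjoint_groups S \<and> \<not> joint_groups S"
    unfolding disjoint_groups_iff[OF S] joint_groups_iff[OF S] by auto
qed

end
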